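(* Let $X$ be a compact Hausdorff space and let $\Gamma$ be a discrete group acting on $X$ by homeomorphisms. Put $C=C(X)\rtimes_r\Gamma$ and $D=C(X)\subseteq C$, and let $D^c$ be the relative commutant of $D$ in $C$. Suppose $X$ is connected, $D^c$ is abelian, and there is $s\in\Gamma$ such that $\emptyset\neq(\operatorname{fix}s)^\circ\neq X$. Then there is no conditional expectation $\Delta\colon C\to D^c$.
   Context: $C(X)\rtimes_r\Gamma$ is the reduced crossed product. For $s\in\Gamma$, $\operatorname{fix}s=\{x\in X:sx=x\}$, and $(\operatorname{fix}s)^\circ$ is its interior. A conditional expectation $\Delta\colon C\to D^c$ is a completely positive contraction of $C$ onto $D^c$ that restricts to the identity on $D^c$. *)

theory Defs
  imports "HOL-Analysis.Analysis"
begin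

section \<open>The complex Hilbert space of square-summable families\<close>

lemma square_summable_mult:
  fixes f g :: "'i \<Rightarrow> complex"
  assumes "(\<lambda>i. (cmod (f i))\<^sup>2) summable_on UNIV" and "(\<lambda>i. (cmod (g i))\<^sup>2) summable_on UNIV"
  shows "(\<lambda>i. cmod (f i) * cmod (g i)) summable_on UNIV"
proof (rule summable_on_comparison_test)
  show "(\<lambda>i. (cmod (f i))\<^sup>2 + (cmod (g i))\<^sup>2) summable_on UNIV"
    by (rule summable_on_add[OF assms])
  show "cmod (f i) * cmod (g i) \<le> (cmod (f i))\<^sup>2 + (cmod (g i))\<^sup>2" for i
  proof -
    have "2 * cmod (f i) * cmod (g i) \<le> (cmod (f i))\<^sup>2 + (cmod (g i))\<^sup>2"
      by (rule sum_squares_bound)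
    moreover have "0 \<le> cmod (f i) * cmod (g i)"
      by simp
    ultimately show ?thesis by linarith
  qed
qed simp

lemma square_summable_add:
  fixes f g :: "'i \<Rightarrow> complex"
  assumes "(\<lambda>i. (cmod (f i))\<^sup>2) summable_on UNIV" and "(\<lambda>i. (cmod (g i))\<^sup>2) summable_on UNIV"
  shows "(\<lambda>i. (cmod (f i + g i))\<^sup>2) summable_on UNIV"
proof (rule summable_on_comparison_test)
  show "(\<lambda>i. (cmod (f i))\<^sup>2 + (cmod (g i))\<^sup>2 + 2 * (cmod (f i) * cmod (g i))) summable_on UNIV"
    by (intro summable_on_add assms summable_on_cmult_right square_summable_mult)
  show "(cmod (f i + g i))\<^sup>2 \<le> (cmod (f i))\<^sup>2 + (cmod (g i))\<^sup>2 + 2 * (cmod (f i) * cmod (g i))" for i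
    using power_mono[OF norm_triangle_ineq[of "f i" "g i"], of 2]
    by (simp add: power2_sum algebra_simps)
qed simp

lemma square_summable_mult_bounded:
  fixes f m :: "'i \<Rightarrow> complex"
  assumes "(\<lambda>i. (cmod (f i))\<^sup>2) summable_on UNIV" and "\<And>i. cmod (m i) \<le> B"
  shows "(\<lambda>i. (cmod (m i * f i))\<^sup>2) summable_on UNIV"
proof (rule summable_on_comparison_test)
  show "(\<lambda>i. B\<^sup>2 * (cmod (f i))\<^sup>2) summable_on UNIV"
    by (intro assms summable_on_cmult_right)
  show "(cmod (m i * f i))\<^sup>2 \<le> B\<^sup>2 * (cmod (f i))\<^sup>2" for i
    using power_mono[OF assms(2)[of i], of 2]
    by (auto simp: norm_mult power_mult_distrib intro!: mult_right_mono)
qed simp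

typedef 'i ell2 = "{f :: 'i \<Rightarrow> complex. (\<lambda>i. (cmod (f i))\<^sup>2) summable_on UNIV}"
  by (rule exI[of _ "\<lambda>_. 0"]) simp

setup_lifting type_definition_ell2

lemma Rep_ell2_summable: "(\<lambda>i. (cmod (Rep_ell2 \<xi> i))\<^sup>2) summable_on UNIV"
  using Rep_ell2 by auto

definition cinner :: "'i ell2 \<Rightarrow> 'i ell2 \<Rightarrow> complex" where
  "cinner \<xi> \<eta> = (\<Sum>\<^sub>\<infinity>i. Rep_ell2 \<xi> i * cnj (Rep_ell2 \<eta> i))"

lemma cinner_summable:
  "(\<lambda>i. Rep_ell2 \<xi> i * cnj (Rep_ell2 \<eta> i)) summable_on UNIV"
  by (rule abs_summable_summable)
    (simp add: norm_mult square_summable_mult[OF Rep_ell2_summable Rep_ell2_summable])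

text \<open>The underlying real Hilbert space, with inner product the real part of \<^const>\<open>cinner\<close>;
  it induces the usual norm.\<close>

instantiation ell2 :: (type) real_vector
begin

lift_definition zero_ell2 :: "'i ell2" is "\<lambda>_. 0" by simp
lift_definition plus_ell2 :: "'i ell2 \<Rightarrow> 'i ell2 \<Rightarrow> 'i ell2" is "\<lambda>f g i. f i + g i"
  by (rule square_summable_add)
lift_definition uminus_ell2 :: "'i ell2 \<Rightarrow> 'i ell2" is "\<lambda>f i. - f i" by simp
lift_definition minus_ell2 :: "'i ell2 \<Rightarrow> 'i ell2 \<Rightarrow> 'i ell2" is "\<lambda>f g i. f i - g i"
  using square_summable_add[of _ "\<lambda>i. - _ i"] by simp
lift_definition scaleR_ell2 :: "real \<Rightarrow> 'i ell2 \<Rightarrow> 'i ell2" is "\<lambda>r f i. of_real r * f i"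
  by (rule square_summable_mult_bounded) auto

instance
proof
  fix x y z :: "'i ell2" and r s :: real
  show "x + y + z = x + (y + z)" "x + y = y + x" "0 + x = x" "- x + x = 0" "x - y = x + - y"
    by (transfer, simp add: algebra_simps)+
  show "r *\<^sub>R (x + y) = r *\<^sub>R x + r *\<^sub>R y" "(r + s) *\<^sub>R x = r *\<^sub>R x + s *\<^sub>R x"
    "r *\<^sub>R s *\<^sub>R x = (r * s) *\<^sub>R x" "1 *\<^sub>R x = x"
    by (transfer, simp add: algebra_simps)+
qed

end

instantiation ell2 :: (type) real_inner
begin

definition inner_ell2 :: "'i ell2 \<Rightarrow> 'i ell2 \<Rightarrow> real" where
  "inner_ell2 \<xi> \<eta> = Re (cinner \<xi> \<eta>)"
definition norm_ell2 :: "'i ell2 \<Rightarrow> real" where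
  "norm_ell2 \<xi> = sqrt (inner \<xi> \<xi>)"
definition dist_ell2 :: "'i ell2 \<Rightarrow> 'i ell2 \<Rightarrow> real" where
  "dist_ell2 \<xi> \<eta> = norm (\<xi> - \<eta>)"
definition sgn_ell2 :: "'i ell2 \<Rightarrow> 'i ell2" where
  "sgn_ell2 \<xi> = scaleR (inverse (norm \<xi>)) \<xi>"
definition uniformity_ell2 :: "('i ell2 \<times> 'i ell2) filter" where
  "uniformity_ell2 = (INF e\<in>{0<..}. principal {(x, y). dist x y < e})"
definition open_ell2 :: "'i ell2 set \<Rightarrow> bool" where
  "open_ell2 U = (\<forall>x\<in>U. eventually (\<lambda>(x', y). x' = x \<longrightarrow> y \<in> U) uniformity)"

instance
proof
  fix x y z :: "'i ell2" and r :: real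
  show "dist x y = norm (x - y)" by (rule dist_ell2_def)
  show "sgn x = x /\<^sub>R norm x" by (rule sgn_ell2_def)
  show "uniformity = (INF e\<in>{0<..}. principal {(x :: 'i ell2, y). dist x y < e})"
    by (rule uniformity_ell2_def)
  show "open U = (\<forall>x\<in>U. \<forall>\<^sub>F (x', y) in uniformity. x' = x \<longrightarrow> y \<in> U)" for U :: "'i ell2 set"
    by (rule open_ell2_def)
  show "norm x = sqrt (inner x x)" by (rule norm_ell2_def)
  have Re_eq: "inner u v = (\<Sum>\<^sub>\<infinity>i. Re (Rep_ell2 u i * cnj (Rep_ell2 v i)))" for u v :: "'i ell2"
    unfolding inner_ell2_def cinner_def by (rule infsum_Re[OF cinner_summable, symmetric])
  show "inner x y = inner y x"
    by (simp add: Re_eq mult.commute)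
  show "inner (x + y) z = inner x z + inner y z"
    by (simp add: inner_ell2_def cinner_def plus_ell2.rep_eq distrib_right
        infsum_add[OF cinner_summable cinner_summable])
  show "inner (r *\<^sub>R x) y = r * inner x y"
    by (simp add: inner_ell2_def cinner_def scaleR_ell2.rep_eq mult.assoc infsum_cmult_right')
  have diag: "Re (Rep_ell2 x i * cnj (Rep_ell2 x i)) = (cmod (Rep_ell2 x i))\<^sup>2" for i
    by (simp add: complex_mult_cnj cmod_power2)
  have xx: "inner x x = (\<Sum>\<^sub>\<infinity>i. (cmod (Rep_ell2 x i))\<^sup>2)"
    unfolding Re_eq diag ..
  show "0 \<le> inner x x"
    unfolding xx by (intro infsum_nonneg) simp
  show "inner x x = 0 \<longleftrightarrow> x = 0"
  proof
    assume "inner x x = 0"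
    then have "(cmod (Rep_ell2 x i))\<^sup>2 = 0" for i
      using nonneg_infsum_le_0D[of "\<lambda>i. (cmod (Rep_ell2 x i))\<^sup>2" UNIV i] Rep_ell2_summable[of x]
      by (auto simp: xx)
    then show "x = 0"
      by (simp add: Rep_ell2_inject[symmetric] zero_ell2.rep_eq fun_eq_iff)
  next
    assume "x = 0"
    then have "Rep_ell2 x i = 0" for i
      by (simp add: zero_ell2.rep_eq)
    then show "inner x x = 0"
      unfolding xx by simp
  qed
qed

end

lemma norm_ell2_eq: "norm \<xi> = sqrt (\<Sum>\<^sub>\<infinity>i. (cmod (Rep_ell2 \<xi> i))\<^sup>2)"
proof -
  have "Re (cinner \<xi> \<xi>) = (\<Sum>\<^sub>\<infinity>i. Re (Rep_ell2 \<xi> i * cnj (Rep_ell2 \<xi> i)))"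
    unfolding cinner_def by (rule infsum_Re[OF cinner_summable, symmetric])
  then show ?thesis
    by (simp add: norm_ell2_def inner_ell2_def complex_mult_cnj cmod_power2)
qed

section \<open>Bounded operators\<close>

text \<open>The norm on \<^typ>\<open>'i ell2 \<Rightarrow>\<^sub>L 'i ell2\<close> is the operator norm.  This type contains all
  real-linear bounded operators; all operators below are complex-linear.\<close>

type_synonym 'i op = "'i ell2 \<Rightarrow>\<^sub>L 'i ell2"

definition is_adjoint :: "'i op \<Rightarrow> 'i op \<Rightarrow> bool" where
  "is_adjoint T S \<longleftrightarrow> (\<forall>\<xi> \<eta>. cinner (T \<xi>) \<eta> = cinner \<xi> (S \<eta>))"

definition mult_op :: "('i \<Rightarrow> complex) \<Rightarrow> 'i op" where
  "mult_op m = Blinfun (\<lambda>\<xi>. Abs_ell2 (\<lambda>i. m i * Rep_ell2 \<xi> i))"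

definition reindex_op :: "('i \<Rightarrow> 'i) \<Rightarrow> 'i op" where
  "reindex_op \<sigma> = Blinfun (\<lambda>\<xi>. Abs_ell2 (\<lambda>i. Rep_ell2 \<xi> (\<sigma> i)))"

definition cscale :: "complex \<Rightarrow> 'i op \<Rightarrow> 'i op" where
  "cscale c T = mult_op (\<lambda>_. c) o\<^sub>L T"

lemma mult_op_apply:
  assumes "\<And>i. cmod (m i) \<le> B"
  shows "Rep_ell2 (mult_op m \<xi>) = (\<lambda>i. m i * Rep_ell2 \<xi> i)"
proof -
  have rep: "Rep_ell2 (Abs_ell2 (\<lambda>i. m i * Rep_ell2 \<xi> i)) = (\<lambda>i. m i * Rep_ell2 \<xi> i)" for \<xi>
    by (rule Abs_ell2_inverse) (simp add: square_summable_mult_bounded[OF Rep_ell2_summable assms])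
  have B: "0 \<le> B"
    using assms[of undefined] norm_ge_zero[of "m undefined"] by linarith
  have "bounded_linear (\<lambda>\<xi>. Abs_ell2 (\<lambda>i. m i * Rep_ell2 \<xi> i))"
  proof (rule bounded_linear_intro[where K = B])
    fix \<xi> \<eta> :: "'a ell2" and r :: real
    show "Abs_ell2 (\<lambda>i. m i * Rep_ell2 (\<xi> + \<eta>) i)
        = Abs_ell2 (\<lambda>i. m i * Rep_ell2 \<xi> i) + Abs_ell2 (\<lambda>i. m i * Rep_ell2 \<eta> i)"
      by (rule Rep_ell2_inject[THEN iffD1], subst rep) (simp add: plus_ell2.rep_eq rep algebra_simps)
    show "Abs_ell2 (\<lambda>i. m i * Rep_ell2 (r *\<^sub>R \<xi>) i) = r *\<^sub>R Abs_ell2 (\<lambda>i. m i * Rep_ell2 \<xi> i)"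
      by (rule Rep_ell2_inject[THEN iffD1], subst rep) (simp add: scaleR_ell2.rep_eq rep algebra_simps)
    have "(\<Sum>\<^sub>\<infinity>i. (cmod (m i * Rep_ell2 \<xi> i))\<^sup>2) \<le> (\<Sum>\<^sub>\<infinity>i. B\<^sup>2 * (cmod (Rep_ell2 \<xi> i))\<^sup>2)"
    proof (rule infsum_mono)
      show "(\<lambda>i. (cmod (m i * Rep_ell2 \<xi> i))\<^sup>2) summable_on UNIV"
        by (rule square_summable_mult_bounded[OF Rep_ell2_summable assms])
      show "(\<lambda>i. B\<^sup>2 * (cmod (Rep_ell2 \<xi> i))\<^sup>2) summable_on UNIV"
        by (intro summable_on_cmult_right Rep_ell2_summable)
      show "(cmod (m i * Rep_ell2 \<xi> i))\<^sup>2 \<le> B\<^sup>2 * (cmod (Rep_ell2 \<xi> i))\<^sup>2" for i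
        using power_mono[OF assms[of i], of 2]
        by (auto simp: norm_mult power_mult_distrib intro!: mult_right_mono)
    qed
    then have "norm (Abs_ell2 (\<lambda>i. m i * Rep_ell2 \<xi> i))
        \<le> sqrt (B\<^sup>2 * (\<Sum>\<^sub>\<infinity>i. (cmod (Rep_ell2 \<xi> i))\<^sup>2))"
      unfolding norm_ell2_eq rep by (simp add: infsum_cmult_right')
    then show "norm (Abs_ell2 (\<lambda>i. m i * Rep_ell2 \<xi> i)) \<le> norm \<xi> * B"
      using B by (simp add: norm_ell2_eq[of \<xi>] real_sqrt_mult mult.commute)
  qed
  then show ?thesis
    by (simp add: mult_op_def bounded_linear_Blinfun_apply rep)
qed

lemma reindex_op_apply:
  assumes "bij \<sigma>"
  shows "Rep_ell2 (reindex_op \<sigma> \<xi>) = (\<lambda>i. Rep_ell2 \<xi> (\<sigma> i))"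
proof -
  have rep: "Rep_ell2 (Abs_ell2 (\<lambda>i. Rep_ell2 \<xi> (\<sigma> i))) = (\<lambda>i. Rep_ell2 \<xi> (\<sigma> i))" for \<xi>
    by (rule Abs_ell2_inverse)
      (use summable_on_reindex_bij_betw[OF assms, of "\<lambda>i. (cmod (Rep_ell2 \<xi> i))\<^sup>2"] Rep_ell2
       in auto)
  have "bounded_linear (\<lambda>\<xi>. Abs_ell2 (\<lambda>i. Rep_ell2 \<xi> (\<sigma> i)))"
  proof (rule bounded_linear_intro[where K = 1])
    fix \<xi> \<eta> :: "'a ell2" and r :: real
    show "Abs_ell2 (\<lambda>i. Rep_ell2 (\<xi> + \<eta>) (\<sigma> i))
        = Abs_ell2 (\<lambda>i. Rep_ell2 \<xi> (\<sigma> i)) + Abs_ell2 (\<lambda>i. Rep_ell2 \<eta> (\<sigma> i))"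
      by (rule Rep_ell2_inject[THEN iffD1], subst rep) (simp add: plus_ell2.rep_eq rep algebra_simps)
    show "Abs_ell2 (\<lambda>i. Rep_ell2 (r *\<^sub>R \<xi>) (\<sigma> i)) = r *\<^sub>R Abs_ell2 (\<lambda>i. Rep_ell2 \<xi> (\<sigma> i))"
      by (rule Rep_ell2_inject[THEN iffD1], subst rep) (simp add: scaleR_ell2.rep_eq rep algebra_simps)
    show "norm (Abs_ell2 (\<lambda>i. Rep_ell2 \<xi> (\<sigma> i))) \<le> norm \<xi> * 1"
      unfolding norm_ell2_eq rep
      using infsum_reindex_bij_betw[OF assms, of "\<lambda>i. (cmod (Rep_ell2 \<xi> i))\<^sup>2"] by simp
  qed
  then show ?thesis
    by (simp add: reindex_op_def bounded_linear_Blinfun_apply rep)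
qed

section \<open>Completely positive maps and conditional expectations\<close>

text \<open>For a self-adjoint, norm-closed complex algebra \<open>A\<close> of operators, \<open>cstar_positive A n a\<close>
  says that the matrix \<open>(a i j)\<close>, \<open>i, j < n\<close>, is a positive element of the C*-algebra
  of \<open>n \<times> n\<close> matrices over \<open>A\<close>, i.e. that it has the form \<open>b\<^sup>* b\<close>; here \<open>c i j\<close> is the adjoint
  of \<open>b i j\<close>.\<close>

definition cstar_positive :: "'i op set \<Rightarrow> nat \<Rightarrow> (nat \<Rightarrow> nat \<Rightarrow> 'i op) \<Rightarrow> bool" where
  "cstar_positive A n a \<longleftrightarrow>
    (\<exists>b c. (\<forall>i<n. \<forall>j<n. b i j \<in> A \<and> c i j \<in> A \<and> is_adjoint (b i j) (c i j)) \<and>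
           (\<forall>i<n. \<forall>j<n. a i j = (\<Sum>k<n. c k i o\<^sub>L b k j)))"

definition clinear_on :: "'i op set \<Rightarrow> ('i op \<Rightarrow> 'i op) \<Rightarrow> bool" where
  "clinear_on A \<Phi> \<longleftrightarrow>
    (\<forall>a\<in>A. \<forall>b\<in>A. \<Phi> (a + b) = \<Phi> a + \<Phi> b) \<and> (\<forall>a\<in>A. \<forall>z. \<Phi> (cscale z a) = cscale z (\<Phi> a))"

definition completely_positive :: "'i op set \<Rightarrow> 'i op set \<Rightarrow> ('i op \<Rightarrow> 'i op) \<Rightarrow> bool" where
  "completely_positive A B \<Phi> \<longleftrightarrow>
    clinear_on A \<Phi> \<and> \<Phi> ` A \<subseteq> B \<and>
    (\<forall>n a. cstar_positive A n a \<longrightarrow> cstar_positive B n (\<lambda>i j. \<Phi> (a i j)))"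

definition conditional_expectation :: "'i op set \<Rightarrow> 'i op set \<Rightarrow> ('i op \<Rightarrow> 'i op) \<Rightarrow> bool" where
  "conditional_expectation A B \<Delta> \<longleftrightarrow>
    completely_positive A B \<Delta> \<and> (\<forall>a\<in>A. norm (\<Delta> a) \<le> norm a) \<and>
    \<Delta> ` A = B \<and> (\<forall>b\<in>B. \<Delta> b = b)"

definition relative_commutant :: "'i op set \<Rightarrow> 'i op set \<Rightarrow> 'i op set" where
  "relative_commutant D A = {a\<in>A. \<forall>d\<in>D. a o\<^sub>L d = d o\<^sub>L a}"

definition abelian :: "'i op set \<Rightarrow> bool" where
  "abelian A \<longleftrightarrow> (\<forall>a\<in>A. \<forall>b\<in>A. a o\<^sub>L b = b o\<^sub>L a)"

section \<open>Group actions and the reduced crossed product\<close>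

text \<open>The class \<^class>\<open>group_add\<close> comprises all groups, not only commutative ones, in additive
  notation.\<close>

definition action_by_homeomorphisms :: "('g::group_add \<Rightarrow> 'x::topological_space \<Rightarrow> 'x) \<Rightarrow> bool" where
  "action_by_homeomorphisms \<alpha> \<longleftrightarrow>
    (\<forall>x. \<alpha> 0 x = x) \<and> (\<forall>s t x. \<alpha> (s + t) x = \<alpha> s (\<alpha> t x)) \<and>
    (\<forall>s. homeomorphism UNIV UNIV (\<alpha> s) (\<alpha> (- s)))"

definition fix_set :: "('g \<Rightarrow> 'x \<Rightarrow> 'x) \<Rightarrow> 'g \<Rightarrow> 'x set" where
  "fix_set \<alpha> s = {x. \<alpha> s x = x}"

text \<open>\<open>C(X)\<close> acts faithfully on \<open>\<ell>\<^sup>2(X)\<close> by multiplication.  The regular representation induced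
  from it acts on \<open>\<ell>\<^sup>2(\<Gamma>, \<ell>\<^sup>2(X)) = \<ell>\<^sup>2(X \<times> \<Gamma>)\<close> by
  \<open>(\<pi>(f) \<xi>)(t) = (t\<^sup>-\<^sup>1 \<cdot> f) \<xi>(t)\<close> and \<open>(\<lambda>\<^sub>s \<xi>)(t) = \<xi>(s\<^sup>-\<^sup>1t)\<close>, where \<open>(t\<^sup>-\<^sup>1 \<cdot> f)(x) = f(tx)\<close>.
  The reduced crossed product is the norm closure of the image of \<open>C\<^sub>c(\<Gamma>, C(X))\<close>; up to
  isomorphism it does not depend on the chosen faithful representation of \<open>C(X)\<close>.\<close>

definition reg_fun :: "('g \<Rightarrow> 'x \<Rightarrow> 'x) \<Rightarrow> ('x \<Rightarrow> complex) \<Rightarrow> ('x \<times> 'g) op" where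
  "reg_fun \<alpha> f = mult_op (\<lambda>(x, t). f (\<alpha> t x))"

definition reg_unitary :: "'g::group_add \<Rightarrow> ('x \<times> 'g) op" where
  "reg_unitary s = reindex_op (\<lambda>(x, t). (x, - s + t))"

definition cont_fun_algebra ::
    "('g \<Rightarrow> 'x::topological_space \<Rightarrow> 'x) \<Rightarrow> ('x \<times> 'g) op set" where
  "cont_fun_algebra \<alpha> = {reg_fun \<alpha> f | f. continuous_on UNIV f}"

definition reduced_crossed_product ::
    "('g::group_add \<Rightarrow> 'x::topological_space \<Rightarrow> 'x) \<Rightarrow> ('x \<times> 'g) op set" where
  "reduced_crossed_product \<alpha> =
    closure {\<Sum>s\<in>F. reg_fun \<alpha> (f s) o\<^sub>L reg_unitary s | F f.
              finite F \<and> (\<forall>s\<in>F. continuous_on UNIV (f s))}"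

lemma reg_fun_apply:
  assumes "compact (UNIV :: 'x set)" and "continuous_on UNIV f"
  shows "Rep_ell2 (reg_fun \<alpha> f \<xi>) (x :: 'x::topological_space, t) = f (\<alpha> t x) * Rep_ell2 \<xi> (x, t)"
proof -
  have "bounded (range f)"
    by (intro compact_imp_bounded compact_continuous_image assms)
  then obtain B where "\<And>x. cmod (f x) \<le> B"
    by (auto simp: bounded_iff)
  then show ?thesis
    unfolding reg_fun_def by (subst mult_op_apply[where B = B]) auto
qed

lemma reg_unitary_apply:
  "Rep_ell2 (reg_unitary s \<xi>) (x, t) = Rep_ell2 \<xi> (x, - s + t)"
proof -
  have "bij (\<lambda>(x :: 'a, t :: 'b). (x, - s + t))"
    by (rule bij_betw_byWitness[where f' = "\<lambda>(x, t). (x, s + t)"]) (auto simp: add.assoc[symmetric])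
  then show ?thesis
    unfolding reg_unitary_def by (subst reindex_op_apply) auto
qed

end

theory Submission
  imports Defs
begin

text \<open>Suppose \<open>\<Delta>\<close> is a conditional expectation onto \<open>D\<^sup>c\<close>, let \<open>U\<close> be the interior of
  \<open>fix s\<close> and put \<open>v = \<Delta>(\<lambda>\<^sub>s)\<close>.  Every element of the crossed product has a Fourier
  coefficient at \<open>s\<close>, which is a \<^emph>\<open>continuous\<close> function on \<open>X\<close>.  The contradiction is that the
  coefficient of \<open>v\<close> is forced to be the indicator function of \<open>U\<close>, so that \<open>U\<close> is clopen in
  the connected space \<open>X\<close>.

  \<^item> The coefficient vanishes off \<open>U\<close>: as \<open>v\<close> commutes with \<open>C(X)\<close>, its coefficient \<open>\<phi>\<close> satisfies
    \<open>f(s\<^sup>-\<^sup>1x) \<phi>(x) = f(x) \<phi>(x)\<close> for all \<open>f\<close>, so \<open>\<phi>\<close> vanishes wherever \<open>s\<close> moves \<open>x\<close>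
    (lemma \<open>fourier_coeff_relative_commutant\<close>); the set \<open>{\<phi> \<noteq> 0}\<close> is open
    and contained in \<open>fix s\<close>, hence contained in \<open>U\<close>.
  \<^item> The coefficient is 1 on \<open>U\<close>: if \<open>h \<in> C(X)\<close> vanishes off \<open>U\<close>, then \<open>\<lambda>\<^sub>s h\<close> already
    belongs to \<open>D\<^sup>c\<close> (lemma \<open>unitary_times_function_in_relative_commutant\<close>), whence
    \<open>\<lambda>\<^sub>s h = \<Delta>(\<lambda>\<^sub>s h) = v h\<close> by the module property of \<open>\<Delta>\<close>
    (lemma \<open>conditional_expectation_right_module\<close>).  Comparing coefficients gives \<open>\<phi> = 1\<close>
    wherever \<open>h \<noteq> 0\<close>.\<close>

lemma id_blinfun_compose [simp]: "id_blinfun o\<^sub>L T = T" "T o\<^sub>L id_blinfun = T"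
  by (rule blinfun_eqI, simp)+

section \<open>Conditional expectations are module maps\<close>

text \<open>If \<open>p = b\<^sup>* b\<close>, then \<open>\<langle>p x, x\<rangle> = \<parallel>b x\<parallel>\<^sup>2\<close>, so \<open>p x = b\<^sup>* (b x)\<close> vanishes as soon as the
  quadratic form does.\<close>

lemma cstar_positive_isotropic_imp_kernel:
  fixes x :: "nat \<Rightarrow> 'i ell2"
  assumes pos: "cstar_positive A n p"
    and isotropic: "(\<Sum>i<n. inner (x i) (\<Sum>j<n. p i j (x j))) = 0"
    and "i < n"
  shows "(\<Sum>j<n. p i j (x j)) = 0"
proof -
  obtain b c where adj: "\<And>i j. i < n \<Longrightarrow> j < n \<Longrightarrow> is_adjoint (b i j) (c i j)"
    and p: "\<And>i j. i < n \<Longrightarrow> j < n \<Longrightarrow> p i j = (\<Sum>k<n. c k i o\<^sub>L b k j)"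
    using pos unfolding cstar_positive_def by blast
  define y where "y k = (\<Sum>j<n. b k j (x j))" for k
  have px: "(\<Sum>j<n. p i j (x j)) = (\<Sum>k<n. c k i (y k))" if "i < n" for i
  proof -
    have "(\<Sum>j<n. p i j (x j)) = (\<Sum>j<n. \<Sum>k<n. c k i (b k j (x j)))"
      using that by (intro sum.cong) (simp_all add: p blinfun.sum_left)
    also have "\<dots> = (\<Sum>k<n. c k i (y k))"
      unfolding y_def by (subst sum.swap) (simp add: blinfun.sum_right)
    finally show ?thesis .
  qed
  have "(\<Sum>k<n. inner (y k) (y k)) = (\<Sum>k<n. \<Sum>i<n. inner (b k i (x i)) (y k))"
    by (simp add: y_def inner_sum_left)
  also have "\<dots> = (\<Sum>k<n. \<Sum>i<n. inner (x i) (c k i (y k)))"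
    using adj by (intro sum.cong) (simp_all add: is_adjoint_def inner_ell2_def)
  also have "\<dots> = (\<Sum>i<n. inner (x i) (\<Sum>j<n. p i j (x j)))"
    by (subst sum.swap) (simp add: px inner_sum_right)
  finally have "(\<Sum>k<n. inner (y k) (y k)) = 0"
    using isotropic by simp
  then have "y k = 0" if "k < n" for k
    using that by (simp add: sum_nonneg_eq_0_iff)
  then show ?thesis
    using px[OF \<open>i < n\<close>] by simp
qed

text \<open>The row \<open>r = (1, k, a\<^sup>*)\<close> gives the positive matrix \<open>r\<^sup>* r\<close>, and \<open>E\<close> fixes its upper left
  \<open>2 \<times> 2\<close> block.  The vector \<open>(- k \<eta>, \<eta>, 0)\<close> is isotropic for that block, so the image matrix
  kills it; the third row reads \<open>E(a k) \<eta> = E(a) k \<eta>\<close>.  This replaces the usual appeal to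
  projections in the bidual, or to multiplicative domains.\<close>

lemma conditional_expectation_right_module:
  assumes E: "conditional_expectation A B E" and "B \<subseteq> A" "0 \<in> A"
    and B: "id_blinfun \<in> B" "k \<in> B" "k' \<in> B" "k' o\<^sub>L k \<in> B" and k: "is_adjoint k k'"
    and a: "a \<in> A" "a' \<in> A" "is_adjoint a' a"
  shows "E (a o\<^sub>L k) = E a o\<^sub>L k"
proof (rule blinfun_eqI)
  fix \<eta>
  define r where "r = (\<lambda>j::nat. if j = 0 then id_blinfun else if j = 1 then k else a')"
  define r' where "r' = (\<lambda>j::nat. if j = 0 then id_blinfun else if j = 1 then k' else a)"
  define p where "p i j = r' i o\<^sub>L r j" for i j
  define x where "x = (\<lambda>j::nat. if j = 0 then - k \<eta> else if j = 1 then \<eta> else 0)"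
  have fixed: "E b = b" if "b \<in> B" for b
    using E that unfolding conditional_expectation_def by blast
  \<comment> \<open>Here \<open>p = b\<^sup>* b\<close> for the \<open>3 \<times> 3\<close> matrix \<open>b\<close> with first row \<open>r\<close> and all other entries zero.\<close>
  have "cstar_positive A 3 p"
    unfolding cstar_positive_def
  proof (intro exI conjI allI impI)
    fix i j :: nat
    show "(if i = 0 then r j else 0) \<in> A" "(if i = 0 then r' j else 0) \<in> A"
      using assms by (auto simp: r_def r'_def)
    show "is_adjoint (if i = 0 then r j else 0) (if i = 0 then r' j else 0)"
      using k a by (auto simp: r_def r'_def is_adjoint_def cinner_def zero_ell2.rep_eq)
    show "p i j = (\<Sum>l<3::nat. (if l = 0 then r' i else 0) o\<^sub>L (if l = 0 then r j else 0))"
      by (rule blinfun_eqI)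
         (simp add: p_def numeral_3_eq_3 blinfun.add_left)
  qed
  then have "cstar_positive B 3 (\<lambda>i j. E (p i j))"
    using E unfolding conditional_expectation_def completely_positive_def by blast
  moreover have "(\<Sum>i<3. inner (x i) (\<Sum>j<3. E (p i j) (x j))) = 0"
    using B by (simp add: numeral_3_eq_3 p_def r_def r'_def x_def fixed blinfun.minus_right)
  ultimately have "(\<Sum>j<3. E (p 2 j) (x j)) = 0"
    by (rule cstar_positive_isotropic_imp_kernel) simp
  then show "E (a o\<^sub>L k) \<eta> = (E a o\<^sub>L k) \<eta>"
    by (simp add: numeral_3_eq_3 p_def r_def r'_def x_def blinfun.minus_right)
qed

section \<open>Separation by continuous functions\<close>

lemma exists_separating_function:
  fixes S T :: "'x::t2_space set"
  assumes compact_UNIV: "compact (UNIV :: 'x set)"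
    and "closed S" and "closed T" and "S \<inter> T = {}"
  obtains h :: "'x \<Rightarrow> real" where "continuous_on UNIV h"
    and "\<And>x. x \<in> S \<Longrightarrow> h x = 0" and "\<And>x. x \<in> T \<Longrightarrow> h x = 1"
proof -
  have "Hausdorff_space (euclidean :: 'x topology)"
    unfolding Hausdorff_space_def by (auto simp: disjnt_def dest!: hausdorff)
  then have "normal_space (euclidean :: 'x topology)"
    using compact_UNIV by (simp add: compact_space_def compact_Hausdorff_or_regular_imp_normal_space)
  moreover have "closedin euclidean S" "closedin euclidean T" "disjnt S T"
    using assms(2-) by (auto simp: disjnt_def)
  ultimately obtain h where "continuous_map euclidean (top_of_set {0..1::real}) h"
    "h ` S \<subseteq> {0}" "h ` T \<subseteq> {1}"
    using Urysohn_lemma[of euclidean S T 0 1] by auto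
  then show ?thesis
    by (intro that[of h]) (auto simp: continuous_map_in_subtopology)
qed

section \<open>Coordinates and the standard basis\<close>

lemma cmod_Rep_ell2_le_norm: "cmod (Rep_ell2 \<xi> i) \<le> norm \<xi>"
proof -
  have "(cmod (Rep_ell2 \<xi> i))\<^sup>2 = (\<Sum>\<^sub>\<infinity>j\<in>{i}. (cmod (Rep_ell2 \<xi> j))\<^sup>2)"
    by simp
  also have "\<dots> \<le> (\<Sum>\<^sub>\<infinity>j. (cmod (Rep_ell2 \<xi> j))\<^sup>2)"
    by (intro infsum_mono_neutral) (auto simp: Rep_ell2_summable)
  finally show ?thesis
    unfolding norm_ell2_eq by (rule real_le_rsqrt)
qed

definition basis_vector :: "'i \<Rightarrow> 'i ell2" where
  "basis_vector p = Abs_ell2 (\<lambda>i. if i = p then 1 else 0)"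

lemma Rep_basis_vector: "Rep_ell2 (basis_vector p) = (\<lambda>i. if i = p then 1 else 0)"
proof -
  have "(\<lambda>i. (cmod (if i = p then 1 else 0))\<^sup>2) summable_on UNIV
      \<longleftrightarrow> (\<lambda>i. (cmod (if i = p then 1 else 0))\<^sup>2) summable_on {p}"
    by (rule summable_on_cong_neutral) auto
  then show ?thesis
    unfolding basis_vector_def by (intro Abs_ell2_inverse) simp
qed

lemma norm_basis_vector: "norm (basis_vector p) = 1"
proof -
  have "(\<Sum>\<^sub>\<infinity>i. (cmod (if i = p then 1 else 0))\<^sup>2) = (\<Sum>\<^sub>\<infinity>i\<in>{p}. (cmod (if i = p then 1 else 0))\<^sup>2)"
    by (rule infsum_cong_neutral) auto
  then show ?thesis
    by (simp add: norm_ell2_eq Rep_basis_vector)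
qed

lemma op_eqI:
  fixes S T :: "('x \<times> 'g) op"
  assumes "\<And>\<xi> x t. Rep_ell2 (S \<xi>) (x, t) = Rep_ell2 (T \<xi>) (x, t)"
  shows "S = T"
  using assms by (intro blinfun_eqI) (auto simp: Rep_ell2_inject[symmetric] fun_eq_iff)

lemma is_adjoint_reg_unitary: "is_adjoint (reg_unitary (- s)) (reg_unitary s :: ('x \<times> 'g::group_add) op)"
proof -
  have bij: "bij_betw (\<lambda>(x :: 'x, t). (x, s + t)) UNIV UNIV"
    by (rule bij_betw_byWitness[where f' = "\<lambda>(x, t). (x, - s + t)"]) (auto simp: add.assoc[symmetric])
  show ?thesis
    unfolding is_adjoint_def cinner_def
  proof (intro allI)
    fix \<xi> \<eta> :: "('x \<times> 'g) ell2"
    have "(\<Sum>\<^sub>\<infinity>p. Rep_ell2 \<xi> p * cnj (Rep_ell2 (reg_unitary s \<eta>) p))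
        = (\<Sum>\<^sub>\<infinity>p. Rep_ell2 \<xi> (case p of (x, t) \<Rightarrow> (x, s + t))
            * cnj (Rep_ell2 (reg_unitary s \<eta>) (case p of (x, t) \<Rightarrow> (x, s + t))))"
      by (rule infsum_reindex_bij_betw[OF bij, symmetric])
    also have "\<dots> = (\<Sum>\<^sub>\<infinity>p. Rep_ell2 (reg_unitary (- s) \<xi>) p * cnj (Rep_ell2 \<eta> p))"
      by (rule infsum_cong) (auto simp: reg_unitary_apply add.assoc[symmetric])
    finally show "(\<Sum>\<^sub>\<infinity>p. Rep_ell2 (reg_unitary (- s) \<xi>) p * cnj (Rep_ell2 \<eta> p))
        = (\<Sum>\<^sub>\<infinity>p. Rep_ell2 \<xi> p * cnj (Rep_ell2 (reg_unitary s \<eta>) p))" ..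
  qed
qed

section \<open>Fourier coefficients in the reduced crossed product\<close>

text \<open>For \<open>T = \<Sum>\<^sub>t \<pi>(f\<^sub>t) \<lambda>\<^sub>t\<close>, the matrix entry of \<open>T\<close> from \<open>(x, s\<^sup>-\<^sup>1)\<close> to \<open>(x, 1)\<close> is
  \<open>f\<^sub>s(x)\<close>.\<close>

definition fourier_coeff :: "'g::group_add \<Rightarrow> ('x \<times> 'g) op \<Rightarrow> 'x \<Rightarrow> complex" where
  "fourier_coeff s T x = Rep_ell2 (T (basis_vector (x, - s))) (x, 0)"

lemma fourier_coeff_zero: "fourier_coeff s 0 x = 0"
  by (simp add: fourier_coeff_def zero_ell2.rep_eq)

lemma fourier_coeff_add: "fourier_coeff s (S + T) x = fourier_coeff s S x + fourier_coeff s T x"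
  by (simp add: fourier_coeff_def blinfun.add_left plus_ell2.rep_eq)

lemma fourier_coeff_diff: "fourier_coeff s (S - T) x = fourier_coeff s S x - fourier_coeff s T x"
  by (simp add: fourier_coeff_def blinfun.diff_left minus_ell2.rep_eq)

lemma fourier_coeff_sum:
  "fourier_coeff s (\<Sum>i\<in>F. T i) x = (\<Sum>i\<in>F. fourier_coeff s (T i) x)"
  by (induction F rule: infinite_finite_induct) (simp_all add: fourier_coeff_zero fourier_coeff_add)

lemma fourier_coeff_reg_unitary: "fourier_coeff s (reg_unitary s) x = 1"
  by (simp add: fourier_coeff_def reg_unitary_apply Rep_basis_vector)

lemma cmod_fourier_coeff_le: "cmod (fourier_coeff s T x) \<le> norm T"
  using cmod_Rep_ell2_le_norm[of "T (basis_vector (x, - s))" "(x, 0)"]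
    norm_blinfun[of T "basis_vector (x, - s)"]
  by (simp add: fourier_coeff_def norm_basis_vector)

context
  fixes \<alpha> :: "'g::group_add \<Rightarrow> 'x::t2_space \<Rightarrow> 'x"
  assumes compact_UNIV: "compact (UNIV :: 'x set)"
    and action: "action_by_homeomorphisms \<alpha>"
begin

lemma action_zero [simp]: "\<alpha> 0 x = x"
  and action_add: "\<alpha> (s + t) x = \<alpha> s (\<alpha> t x)"
  using action unfolding action_by_homeomorphisms_def by auto

lemma action_minus_cancel [simp]: "\<alpha> s (\<alpha> (- s) x) = x" "\<alpha> (- s) (\<alpha> s x) = x"
  by (simp_all flip: action_add)

lemmas reg_apply = reg_fun_apply[OF compact_UNIV, of _ \<alpha>] reg_unitary_apply

text \<open>The generators have continuous coefficients, and \<open>cmod_fourier_coeff_le\<close> makes the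
  coefficient of a norm limit a uniform limit of theirs.\<close>

lemma continuous_fourier_coeff:
  assumes "T \<in> reduced_crossed_product \<alpha>"
  shows "continuous_on UNIV (fourier_coeff s T)"
proof -
  define P where "P = {\<Sum>t\<in>F. reg_fun \<alpha> (f t) o\<^sub>L reg_unitary t | F f.
              finite F \<and> (\<forall>t\<in>F. continuous_on UNIV (f t))}"
  have generator: "continuous_on UNIV (fourier_coeff s (\<Sum>t\<in>F. reg_fun \<alpha> (f t) o\<^sub>L reg_unitary t))"
    if f: "\<forall>t\<in>F. continuous_on UNIV (f t)" for F f
  proof -
    have "fourier_coeff s (\<Sum>t\<in>F. reg_fun \<alpha> (f t) o\<^sub>L reg_unitary t)
        = (\<lambda>x. \<Sum>t\<in>F. f t x * (if t = s then 1 else 0))"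
      unfolding fun_eq_iff fourier_coeff_sum using f
      by (intro allI sum.cong) (auto simp: fourier_coeff_def reg_apply Rep_basis_vector)
    then show ?thesis
      using f by (simp only:) (intro continuous_on_sum continuous_on_mult continuous_on_const, blast)
  qed
  then have P: "continuous_on UNIV (fourier_coeff s S)" if "S \<in> P" for S
    using that by (auto simp: P_def)
  obtain S where S: "\<And>n. S n \<in> P" "S \<longlonglongrightarrow> T"
    using assms unfolding reduced_crossed_product_def P_def[symmetric] closure_sequential by blast
  have "uniform_limit UNIV (\<lambda>n. fourier_coeff s (S n)) (fourier_coeff s T) sequentially"
  proof (rule uniform_limitI)
    fix e :: real assume "0 < e"
    with S(2) have "\<forall>\<^sub>F n in sequentially. dist (S n) T < e"
      by (rule tendstoD)
    then show "\<forall>\<^sub>F n in sequentially. \<forall>x\<in>UNIV.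
        dist (fourier_coeff s (S n) x) (fourier_coeff s T x) < e"
      by eventually_elim
        (auto simp: dist_norm simp flip: fourier_coeff_diff
          intro: le_less_trans[OF cmod_fourier_coeff_le])
  qed
  then show ?thesis
    by (rule uniform_limit_theorem[rotated]) (auto simp: P S)
qed

text \<open>This is restricted to real-valued \<open>h\<close> because \<open>T\<close> is an arbitrary bounded \<^emph>\<open>real\<close>-linear
  operator, past which only real scalars can be moved.\<close>

lemma fourier_coeff_times_function:
  assumes "continuous_on UNIV h"
  shows "fourier_coeff s (T o\<^sub>L reg_fun \<alpha> (\<lambda>x. of_real (h x))) x
    = of_real (h (\<alpha> (- s) x)) * fourier_coeff s T x"
proof -
  have "reg_fun \<alpha> (\<lambda>x. of_real (h x)) (basis_vector (x, - s))
      = h (\<alpha> (- s) x) *\<^sub>R basis_vector (x, - s)"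
    using assms
    by (auto simp: Rep_ell2_inject[symmetric] fun_eq_iff reg_apply continuous_on_of_real
        scaleR_ell2.rep_eq Rep_basis_vector)
  then show ?thesis
    by (simp add: fourier_coeff_def blinfun.scaleR_right scaleR_ell2.rep_eq)
qed

lemma fourier_coeff_function_times:
  assumes "continuous_on UNIV f"
  shows "fourier_coeff s (reg_fun \<alpha> f o\<^sub>L T) x = f x * fourier_coeff s T x"
  using assms by (simp add: fourier_coeff_def reg_apply)

section \<open>Functions and unitaries as elements of the crossed product\<close>

lemma reg_fun_compose:
  assumes "continuous_on UNIV f" and "continuous_on UNIV g"
  shows "reg_fun \<alpha> f o\<^sub>L reg_fun \<alpha> g = reg_fun \<alpha> (\<lambda>x. f x * g x)"
  using assms by (intro op_eqI) (simp add: reg_apply continuous_on_mult)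

lemma reg_fun_one: "reg_fun \<alpha> (\<lambda>_. 1) = id_blinfun"
  by (rule op_eqI) (simp add: reg_apply)

lemma generator_in_crossed_product:
  assumes "continuous_on UNIV f"
  shows "reg_fun \<alpha> f o\<^sub>L reg_unitary s \<in> reduced_crossed_product \<alpha>"
  unfolding reduced_crossed_product_def
  by (rule subsetD[OF closure_subset], clarsimp, rule exI[of _ "{s}"], rule exI[of _ "\<lambda>_. f"])
    (simp add: assms)

lemma zero_in_crossed_product: "0 \<in> reduced_crossed_product \<alpha>"
  unfolding reduced_crossed_product_def
  by (rule subsetD[OF closure_subset], clarsimp, rule exI[of _ "{}"]) simp

lemma reg_unitary_in_crossed_product: "reg_unitary s \<in> reduced_crossed_product \<alpha>"
  using generator_in_crossed_product[of "\<lambda>_. 1" s] by (simp add: reg_fun_one)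

lemma function_in_relative_commutant:
  assumes "continuous_on UNIV f"
  shows "reg_fun \<alpha> f \<in> relative_commutant (cont_fun_algebra \<alpha>) (reduced_crossed_product \<alpha>)"
proof -
  have "reg_fun \<alpha> f = reg_fun \<alpha> f o\<^sub>L reg_unitary 0"
    by (rule op_eqI) (simp add: reg_apply assms)
  then have "reg_fun \<alpha> f \<in> reduced_crossed_product \<alpha>"
    using generator_in_crossed_product[OF assms, of 0] by simp
  then show ?thesis
    by (auto simp: relative_commutant_def cont_fun_algebra_def reg_fun_compose assms mult.commute)
qed

lemma is_adjoint_reg_fun:
  assumes "continuous_on UNIV h"
  shows "is_adjoint (reg_fun \<alpha> (\<lambda>x. of_real (h x))) (reg_fun \<alpha> (\<lambda>x. of_real (h x)))"
  unfolding is_adjoint_def cinner_def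
  by (auto intro!: infsum_cong simp: reg_apply continuous_on_of_real assms)

text \<open>For \<open>h\<close> vanishing off \<open>fix s\<close>, all of \<open>C(X)\<close> commutes with \<open>\<lambda>\<^sub>s h\<close>: where \<open>h\<close> does not
  vanish, \<open>f\<close> and its translate by \<open>s\<close> agree.\<close>

lemma unitary_times_function_in_relative_commutant:
  assumes h: "continuous_on UNIV h" and supp: "\<And>x. x \<notin> fix_set \<alpha> s \<Longrightarrow> h x = 0"
  shows "reg_unitary s o\<^sub>L reg_fun \<alpha> h
    \<in> relative_commutant (cont_fun_algebra \<alpha>) (reduced_crossed_product \<alpha>)"
proof -
  have fixed: "\<alpha> (- s) y = y" if "y \<in> fix_set \<alpha> s \<or> \<alpha> (- s) y \<in> fix_set \<alpha> s" for y
    using that action_minus_cancel(1)[of s y] action_minus_cancel(2)[of s y]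
    unfolding fix_set_def mem_Collect_eq by metis
  have invariant: "h (\<alpha> (- s) y) = h y" for y
    using supp fixed by metis
  have "reg_unitary s o\<^sub>L reg_fun \<alpha> h = reg_fun \<alpha> h o\<^sub>L reg_unitary s"
    by (rule op_eqI) (simp add: reg_apply h action_add invariant)
  then have "reg_unitary s o\<^sub>L reg_fun \<alpha> h \<in> reduced_crossed_product \<alpha>"
    using generator_in_crossed_product[OF h] by simp
  moreover have "(reg_unitary s o\<^sub>L reg_fun \<alpha> h) o\<^sub>L reg_fun \<alpha> f
      = reg_fun \<alpha> f o\<^sub>L (reg_unitary s o\<^sub>L reg_fun \<alpha> h)" if f: "continuous_on UNIV f" for f
  proof (rule op_eqI)
    fix \<xi> x t
    have "h y * f (\<alpha> (- s) y) = f y * h y" for y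
      using fixed[of y] supp[of y] by (metis mult.commute mult_zero_left)
    then show "Rep_ell2 (((reg_unitary s o\<^sub>L reg_fun \<alpha> h) o\<^sub>L reg_fun \<alpha> f) \<xi>) (x, t)
        = Rep_ell2 ((reg_fun \<alpha> f o\<^sub>L (reg_unitary s o\<^sub>L reg_fun \<alpha> h)) \<xi>) (x, t)"
      by (simp add: reg_apply f h action_add invariant mult.assoc[symmetric])
  qed
  ultimately show ?thesis
    by (auto simp: relative_commutant_def cont_fun_algebra_def)
qed

lemma fourier_coeff_relative_commutant:
  assumes v: "v \<in> relative_commutant (cont_fun_algebra \<alpha>) (reduced_crossed_product \<alpha>)"
    and x: "x \<notin> fix_set \<alpha> s"
  shows "fourier_coeff s v x = 0"
proof -
  have "\<alpha> (- s) x \<noteq> x"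
    using x by (metis (mono_tags) action_minus_cancel(1) fix_set_def mem_Collect_eq)
  then obtain h where h: "continuous_on UNIV h" "h x = 0" "h (\<alpha> (- s) x) = (1::real)"
    using exists_separating_function[OF compact_UNIV, of "{x}" "{\<alpha> (- s) x}"] by auto
  have "v o\<^sub>L reg_fun \<alpha> (\<lambda>x. of_real (h x)) = reg_fun \<alpha> (\<lambda>x. of_real (h x)) o\<^sub>L v"
    using v continuous_on_of_real[OF h(1)]
    by (auto simp: relative_commutant_def cont_fun_algebra_def)
  from arg_cong[where f = "\<lambda>T. fourier_coeff s T x", OF this]
  show ?thesis
    by (simp add: fourier_coeff_times_function fourier_coeff_function_times
        continuous_on_of_real h)
qed

end

section \<open>Nonexistence of conditional expectations onto the relative commutant\<close>

theorem proposition5p11: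
  fixes \<alpha> :: "'g::group_add \<Rightarrow> 'x::t2_space \<Rightarrow> 'x"
  assumes "compact (UNIV :: 'x set)"
    and "action_by_homeomorphisms \<alpha>"
    and "connected (UNIV :: 'x set)"
    and "abelian (relative_commutant (cont_fun_algebra \<alpha>) (reduced_crossed_product \<alpha>))"
    and "\<exists>s. interior (fix_set \<alpha> s) \<noteq> {} \<and> interior (fix_set \<alpha> s) \<noteq> UNIV"
  shows "\<not> (\<exists>\<Delta>. conditional_expectation (reduced_crossed_product \<alpha>)
                (relative_commutant (cont_fun_algebra \<alpha>) (reduced_crossed_product \<alpha>)) \<Delta>)"
proof
  let ?C = "reduced_crossed_product \<alpha>"
  let ?Dc = "relative_commutant (cont_fun_algebra \<alpha>) ?C"
  assume "\<exists>\<Delta>. conditional_expectation ?C ?Dc \<Delta>"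
  then obtain \<Delta> where \<Delta>: "conditional_expectation ?C ?Dc \<Delta>" ..
  note X = assms(1,2)
  obtain s where s: "interior (fix_set \<alpha> s) \<noteq> {}" "interior (fix_set \<alpha> s) \<noteq> UNIV"
    using assms(5) by blast
  define U where "U = interior (fix_set \<alpha> s)"
  define v where "v = \<Delta> (reg_unitary s)"
  have v: "v \<in> ?Dc"
    using \<Delta> reg_unitary_in_crossed_product[OF X]
    unfolding v_def conditional_expectation_def by blast
  have cont: "continuous_on UNIV (fourier_coeff s v)"
    using v continuous_fourier_coeff[OF X] by (simp add: relative_commutant_def)
  have one: "fourier_coeff s v x = 1" if "x \<in> U" for x
  proof -
    obtain h where h: "continuous_on UNIV h" "\<And>y. y \<in> - U \<Longrightarrow> h y = 0" "h x = (1::real)"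
      by (rule exists_separating_function[OF X(1), of "- U" "{x}"])
        (use \<open>x \<in> U\<close> in \<open>auto simp: U_def\<close>)
    let ?k = "reg_fun \<alpha> (\<lambda>x. of_real (h x))"
    have ch: "continuous_on UNIV (\<lambda>x. of_real (h x) :: complex)"
      using h(1) by (rule continuous_on_of_real)
    have x: "\<alpha> (- s) x = x"
      using that interior_subset[of "fix_set \<alpha> s"] action_minus_cancel(2)[OF X, of s x]
      by (auto simp: U_def fix_set_def)
    have "\<Delta> (reg_unitary s o\<^sub>L ?k) = v o\<^sub>L ?k"
      unfolding v_def
    proof (rule conditional_expectation_right_module[OF \<Delta>,
          where k' = ?k and a' = "reg_unitary (- s)"])
      show "?Dc \<subseteq> ?C"
        by (auto simp: relative_commutant_def)
      show "id_blinfun \<in> ?Dc"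
        using function_in_relative_commutant[OF X, of "\<lambda>_. 1"] by (simp add: reg_fun_one[OF X])
      show "?k o\<^sub>L ?k \<in> ?Dc"
        using ch by (simp add: reg_fun_compose[OF X] function_in_relative_commutant[OF X]
            continuous_on_mult)
    qed (simp_all add: zero_in_crossed_product[OF X] function_in_relative_commutant[OF X ch]
        is_adjoint_reg_fun[OF X h(1)] is_adjoint_reg_unitary
        reg_unitary_in_crossed_product[OF X])
    moreover have "reg_unitary s o\<^sub>L ?k \<in> ?Dc"
    proof (rule unitary_times_function_in_relative_commutant[OF X ch])
      show "of_real (h y) = (0 :: complex)" if "y \<notin> fix_set \<alpha> s" for y
        using that h(2)[of y] interior_subset[of "fix_set \<alpha> s"] by (auto simp: U_def)
    qed
    ultimately have "reg_unitary s o\<^sub>L ?k = v o\<^sub>L ?k"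
      using \<Delta> unfolding conditional_expectation_def by metis
    from arg_cong[where f = "\<lambda>T. fourier_coeff s T x", OF this] show ?thesis
      using h by (simp add: fourier_coeff_times_function[OF X] fourier_coeff_reg_unitary x)
  qed
  have "{x. fourier_coeff s v x \<noteq> 0} \<subseteq> U"
    unfolding U_def
  proof (rule interior_maximal)
    show "{x. fourier_coeff s v x \<noteq> 0} \<subseteq> fix_set \<alpha> s"
      using fourier_coeff_relative_commutant[OF X v] by blast
    show "open {x. fourier_coeff s v x \<noteq> 0}"
      by (rule open_Collect_neq[OF cont continuous_on_const])
  qed
  with one have "U = {x. fourier_coeff s v x = 1}"
    by auto
  then have "closed U"
    using closed_Collect_eq[OF cont continuous_on_const] by simp
  moreover have "open U"
    by (simp add: U_def)
  ultimately show False
    using assms(3) s unfolding connected_clopen U_def by auto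
qed

end
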